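(* Let $\Sigma$ be a finitary signature and $\mathcal{E}\subseteq T_\Sigma(V)\times T_\Sigma(V)$ a set of inequalities, let $U:\mathbf{DTop}(\Sigma,\mathcal{E})\to\mathbf{DTop}$ be the forgetful functor and $F$ its left adjoint. For every algebraic space $X$, the space $UF(X)$ is algebraic.
   Context: All topological spaces are $T_0$; order-theoretic notions on a space refer to the specialization order $x\sqsubseteq y$ iff $x\in\overline{\{y\}}$. A directed subset $D\subseteq X$ converges to $x$, written $D\to x$, if $D\cap U\neq\emptyset$ for every open neighbourhood $U$ of $x$. A subset $U\subseteq X$ is directed-open if for every directed $D\subseteq X$ and $x\in X$ with $D\to x$, $x\in U$ implies $D\cap U\ne\emptyset$. A directed space is a $T_0$ space in which every directed-open set is open. For a $T_0$ space $Y$, $\mathcal{D}Y$ is the set of $Y$ with the topology of all directed-open subsets of $Y$ (a directed space). $\mathbf{DTop}$ is the category of directed spaces and continuous maps; its categorical product is $X\otimes Y=\mathcal{D}(X\times Y)$ (and similarly for families), where $\times$ is the topological product. For a directed space $X$, $X^n$ denotes the $n$-fold product $X\otimes\dots\otimes X$. In a directed space, $x\ll y$ means that for every directed $D$ with $D\to y$ there is $d\in D$ with $x\sqsubseteq d$; $K(X)=\{x:x\ll x\}$. An algebraic space is a directed space such that for each $x\in X$, $\downarrow x\cap K(X)$ is directed and converges to $x$. A finitary signature $\Sigma=\langle I,\alpha\rangle$ is a set $I$ of operation symbols with an arity map $\alpha:I\to\mathbb{N}$, $n_i:=\alpha(i)$. A $\Sigma$-algebra $\langle A,\{f_i\}_I\rangle$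 is a set $A$ with maps $f_i:A^{n_i}\to A$; homomorphisms are maps commuting with the operations. $T_\Sigma(V)$ is the term algebra over a fixed countable set $V$ of variables; each map $h:V\to A$ into a $\Sigma$-algebra extends uniquely to a homomorphism $\overline h:T_\Sigma(V)\to A$. A dtop-algebra is a $\Sigma$-algebra whose carrier is a directed space and whose operations $f_i:A^{n_i}\to A$ are continuous. A pair $\langle\tau_1,\tau_2\rangle\in\mathcal{E}$ stands for the inequality $\tau_1\le\tau_2$, which holds in $A$ if $\overline h(\tau_1)\sqsubseteq\overline h(\tau_2)$ for every map $h:V\to A$. $\mathbf{DTop}(\Sigma,\mathcal{E})$ is the category of all dtop-algebras with signature $\Sigma$ satisfying all inequalities in $\mathcal{E}$, with continuous homomorphisms as morphisms; $U$ sends an algebra to its carrier space. The left adjoint $F$ of $U$ exists for all $\Sigma,\mathcal{E}$; $F(X)$ is the free algebra over $X$. *)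

theory Defs
  imports "HOL-Analysis.Analysis"
begin

section \<open>Directed spaces\<close>

definition spec_le :: "'a topology \<Rightarrow> 'a \<Rightarrow> 'a \<Rightarrow> bool" where
  "spec_le X x y \<longleftrightarrow> x \<in> X closure_of {y}"

definition directed_in :: "'a topology \<Rightarrow> 'a set \<Rightarrow> bool" where
  "directed_in X D \<longleftrightarrow> D \<subseteq> topspace X \<and> D \<noteq> {} \<and>
     (\<forall>a\<in>D. \<forall>b\<in>D. \<exists>c\<in>D. spec_le X a c \<and> spec_le X b c)"

definition converges_to :: "'a topology \<Rightarrow> 'a set \<Rightarrow> 'a \<Rightarrow> bool" where
  "converges_to X D x \<longleftrightarrow> x \<in> topspace X \<and> (\<forall>U. openin X U \<and> x \<in> U \<longrightarrow> D \<inter> U \<noteq> {})"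

definition directed_open :: "'a topology \<Rightarrow> 'a set \<Rightarrow> bool" where
  "directed_open X U \<longleftrightarrow> U \<subseteq> topspace X \<and>
     (\<forall>D x. directed_in X D \<and> converges_to X D x \<and> x \<in> U \<longrightarrow> D \<inter> U \<noteq> {})"

definition directed_space :: "'a topology \<Rightarrow> bool" where
  "directed_space X \<longleftrightarrow> t0_space X \<and> (\<forall>U. directed_open X U \<longrightarrow> openin X U)"

definition dir_topology :: "'a topology \<Rightarrow> 'a topology" where
  "dir_topology X = topology (directed_open X)"

lemma spec_le_iff:
  "spec_le X x y \<longleftrightarrow> x \<in> topspace X \<and> y \<in> topspace X \<and> (\<forall>U. openin X U \<and> x \<in> U \<longrightarrow> y \<in> U)"
  unfolding spec_le_def in_closure_of using openin_topspace openin_subset by blast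

lemma directed_open_upper:
  assumes U: "directed_open X U" and x: "x \<in> U" and le: "spec_le X x y"
  shows "y \<in> U"
proof -
  have "directed_in X {y}" "converges_to X {y} x"
    using le by (auto simp: directed_in_def converges_to_def spec_le_iff)
  then have "{y} \<inter> U \<noteq> {}"
    using U x unfolding directed_open_def by blast
  then show ?thesis by simp
qed

lemma istopology_directed_open: "istopology (directed_open X)"
  unfolding istopology_def
proof (intro conjI allI impI)
  fix U V assume UV: "directed_open X U" "directed_open X V"
  show "directed_open X (U \<inter> V)"
    unfolding directed_open_def
  proof (intro conjI allI impI)
    show "U \<inter> V \<subseteq> topspace X" using UV unfolding directed_open_def by blast
  next
    fix D x assume D: "directed_in X D \<and> converges_to X D x \<and> x \<in> U \<inter> V"
    then obtain a b where ab: "a \<in> D" "a \<in> U" "b \<in> D" "b \<in> V"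
      using UV unfolding directed_open_def by blast
    then obtain c where "c \<in> D" "spec_le X a c" "spec_le X b c"
      using D unfolding directed_in_def by blast
    then show "D \<inter> (U \<inter> V) \<noteq> {}"
      using ab directed_open_upper[OF UV(1)] directed_open_upper[OF UV(2)] by blast
  qed
next
  fix \<K> assume "\<forall>K\<in>\<K>. directed_open X K"
  then show "directed_open X (\<Union>\<K>)"
    unfolding directed_open_def by blast
qed

lemma openin_dir_topology: "openin (dir_topology X) U \<longleftrightarrow> directed_open X U"
  unfolding dir_topology_def using istopology_directed_open[of X] by (simp add: topology_inverse')

lemma directed_open_if_openin: "openin X U \<Longrightarrow> directed_open X U"
  unfolding directed_open_def converges_to_def using openin_subset by blast

lemma topspace_dir_topology [simp]: "topspace (dir_topology X) = topspace X"
proof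
  show "topspace (dir_topology X) \<subseteq> topspace X"
    using openin_dir_topology[of X] openin_topspace[of "dir_topology X"]
    unfolding directed_open_def by blast
  show "topspace X \<subseteq> topspace (dir_topology X)"
    using directed_open_if_openin[OF openin_topspace] openin_dir_topology openin_subset by metis
qed

text \<open>The \<open>n\<close>-fold product in the category of directed spaces. Its points are the extensional
  functions on \<open>{..<n}\<close>.\<close>

definition dpower :: "'a topology \<Rightarrow> nat \<Rightarrow> (nat \<Rightarrow> 'a) topology" where
  "dpower X n = dir_topology (product_topology (\<lambda>_. X) {..<n})"

definition way_below :: "'a topology \<Rightarrow> 'a \<Rightarrow> 'a \<Rightarrow> bool" where
  "way_below X x y \<longleftrightarrow> x \<in> topspace X \<and> y \<in> topspace X \<and>
     (\<forall>D. directed_in X D \<and> converges_to X D y \<longrightarrow> (\<exists>d\<in>D. spec_le X x d))"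

definition compact_elements :: "'a topology \<Rightarrow> 'a set" where
  "compact_elements X = {x \<in> topspace X. way_below X x x}"

definition algebraic_space :: "'a topology \<Rightarrow> bool" where
  "algebraic_space X \<longleftrightarrow> directed_space X \<and>
     (\<forall>x\<in>topspace X.
        directed_in X {k \<in> compact_elements X. spec_le X k x} \<and>
        converges_to X {k \<in> compact_elements X. spec_le X k x} x)"

section \<open>Signatures, terms and algebras\<close>

record 'i signature =
  symbols :: "'i set"
  arity :: "'i \<Rightarrow> nat"

datatype ('i, 'v) trm = Var 'v | App 'i "('i, 'v) trm list"

inductive_set sig_terms :: "'i signature \<Rightarrow> 'v set \<Rightarrow> ('i, 'v) trm set"
  for \<Sigma> :: "'i signature" and V :: "'v set" where
  Var: "v \<in> V \<Longrightarrow> Var v \<in> sig_terms \<Sigma> V"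
| App: "\<lbrakk>i \<in> symbols \<Sigma>; length ts = arity \<Sigma> i; \<forall>t\<in>set ts. t \<in> sig_terms \<Sigma> V\<rbrakk>
        \<Longrightarrow> App i ts \<in> sig_terms \<Sigma> V"

record ('i, 'a) top_alg =
  alg_space :: "'a topology"
  alg_op :: "'i \<Rightarrow> (nat \<Rightarrow> 'a) \<Rightarrow> 'a"

text \<open>The homomorphic extension of an assignment \<open>h\<close> to terms.\<close>

primrec eval_trm :: "('i \<Rightarrow> (nat \<Rightarrow> 'a) \<Rightarrow> 'a) \<Rightarrow> ('v \<Rightarrow> 'a) \<Rightarrow> ('i, 'v) trm \<Rightarrow> 'a" where
  "eval_trm f h (Var v) = h v"
| "eval_trm f h (App i ts) = f i (\<lambda>k\<in>{..<length ts}. map (eval_trm f h) ts ! k)"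

definition dtop_algebra :: "'i signature \<Rightarrow> ('i, 'a) top_alg \<Rightarrow> bool" where
  "dtop_algebra \<Sigma> A \<longleftrightarrow> directed_space (alg_space A) \<and>
     (\<forall>i\<in>symbols \<Sigma>. continuous_map (dpower (alg_space A) (arity \<Sigma> i)) (alg_space A) (alg_op A i))"

definition satisfies_ineq :: "('i, 'a) top_alg \<Rightarrow> ('i, 'v) trm \<times> ('i, 'v) trm \<Rightarrow> bool" where
  "satisfies_ineq A e \<longleftrightarrow>
     (\<forall>h. (\<forall>v. h v \<in> topspace (alg_space A)) \<longrightarrow>
        spec_le (alg_space A) (eval_trm (alg_op A) h (fst e)) (eval_trm (alg_op A) h (snd e)))"

text \<open>Objects and morphisms of the category of dtop-algebras satisfying the inequalities \<open>E\<close>;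
  the natural numbers serve as the countable set of variables.\<close>

definition dtop_obj ::
  "'i signature \<Rightarrow> (('i, nat) trm \<times> ('i, nat) trm) set \<Rightarrow> ('i, 'a) top_alg \<Rightarrow> bool" where
  "dtop_obj \<Sigma> E A \<longleftrightarrow> dtop_algebra \<Sigma> A \<and> (\<forall>e\<in>E. satisfies_ineq A e)"

definition dtop_hom ::
  "'i signature \<Rightarrow> ('i, 'a) top_alg \<Rightarrow> ('i, 'b) top_alg \<Rightarrow> ('a \<Rightarrow> 'b) \<Rightarrow> bool" where
  "dtop_hom \<Sigma> A B g \<longleftrightarrow> continuous_map (alg_space A) (alg_space B) g \<and>
     (\<forall>i\<in>symbols \<Sigma>. \<forall>a\<in>{..<arity \<Sigma> i} \<rightarrow>\<^sub>E topspace (alg_space A).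
        g (alg_op A i a) = alg_op B i (\<lambda>k\<in>{..<arity \<Sigma> i}. g (a k)))"

section \<open>Free algebras\<close>

text \<open>The universal property of the unit \<open>\<eta> : X \<rightarrow> U F X\<close> of the adjunction between \<open>F\<close> and \<open>U\<close>, tested on the
  algebras \<open>B\<close> whose carrier is a subset of the type \<open>'b\<close>. Morphisms are HOL functions, so
  uniqueness is required on the carrier only.\<close>

definition universal_for ::
  "'b itself \<Rightarrow> 'i signature \<Rightarrow> (('i, nat) trm \<times> ('i, nat) trm) set \<Rightarrow> 'x topology
    \<Rightarrow> ('i, 'a) top_alg \<Rightarrow> ('x \<Rightarrow> 'a) \<Rightarrow> bool" where
  "universal_for (_ :: 'b itself) \<Sigma> E X A \<eta> \<longleftrightarrow>
     (\<forall>(B :: ('i, 'b) top_alg) \<phi>.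
        dtop_obj \<Sigma> E B \<and> continuous_map X (alg_space B) \<phi> \<longrightarrow>
        (\<exists>g. dtop_hom \<Sigma> A B g \<and> (\<forall>x\<in>topspace X. g (\<eta> x) = \<phi> x) \<and>
             (\<forall>g'. dtop_hom \<Sigma> A B g' \<and> (\<forall>x\<in>topspace X. g' (\<eta> x) = \<phi> x) \<longrightarrow>
                   (\<forall>a\<in>topspace (alg_space A). g' a = g a))))"

text \<open>\<open>A\<close> with unit \<open>\<eta>\<close> is a free algebra over the directed space \<open>X\<close>. HOL cannot quantify over
  the type of the test algebras, so two types are tested: that of \<open>A\<close>, and that of sets of terms
  over \<open>X\<close>. This is no restriction. A free algebra is generated by the image of \<open>X\<close>, hence has a
  copy \<open>F\<close> carried by equivalence classes of terms over \<open>X\<close>. Freeness of \<open>F\<close> and testing \<open>A\<close> on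
  \<open>F\<close> give morphisms \<open>F \<rightarrow> A\<close> and \<open>A \<rightarrow> F\<close> under \<open>X\<close>; they are mutually inverse by freeness
  of \<open>F\<close> and by testing \<open>A\<close> on itself. So \<open>A\<close> is isomorphic to \<open>F\<close> and has the universal property
  for all types.\<close>

definition free_algebra ::
  "'i signature \<Rightarrow> (('i, nat) trm \<times> ('i, nat) trm) set \<Rightarrow> 'x topology
    \<Rightarrow> ('i, 'a) top_alg \<Rightarrow> ('x \<Rightarrow> 'a) \<Rightarrow> bool" where
  "free_algebra \<Sigma> E X A \<eta> \<longleftrightarrow>
     dtop_obj \<Sigma> E A \<and> continuous_map X (alg_space A) \<eta> \<and>
     universal_for TYPE('a) \<Sigma> E X A \<eta> \<and>
     universal_for TYPE(('i, 'x) trm set) \<Sigma> E X A \<eta>"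

end

theory Submission
  imports Defs
begin

text \<open>The topology of an algebraic space is governed by its compact elements: its open sets are the unions of
  the sets of points above a compact element, and every point is the limit of the directed set of
  compact elements below it. So a free algebra over \<open>X\<close> ought to be a part of the ideal completion of the free ordered
  algebra over the poset of compact elements. That ordered algebra consists of the terms over compact
  elements, preordered by the least compatible preorder \<open>le\<close> that contains the order of \<open>X\<close> and all
  instances of the inequalities \<open>E\<close>.

  A term \<open>t\<close> over \<open>X\<close> is approximated by the terms obtained from it by replacing each leaf by a compact
  element below it. These approximants are directed, so the terms below one of them form an ideal,
  \<open>ideal t\<close>. The ideals of this form, ordered by inclusion, contain all principal ideals.
  Any family of ideals of a preorder that contains the principal ideals generated by elements of its
  members becomes an algebraic space when the sets \<open>{J. p \<in> J}\<close> are taken as a base of the topology, with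
  the principal ideals as compact elements (\<open>algebraic_ideal_topology\<close>).

  The ideals \<open>ideal t\<close> form a dtop-algebra. Its operations are continuous, already for the topological
  product, because membership of \<open>p\<close> in \<open>f(I\<^sub>1, \<dots>, I\<^sub>n)\<close> is witnessed by one element of each \<open>I\<^sub>k\<close>.
  The inequalities hold because every approximant of an instance \<open>\<tau>[s]\<close> lies below
  some \<open>\<tau>[\<sigma>]\<close> in which all occurrences of a variable \<open>v\<close> are replaced by the same approximant of \<open>s v\<close>
  (\<open>approx_subst_cofinal\<close>).

  This algebra has the universal property. For a continuous \<open>\<phi>\<close> from \<open>X\<close> to an algebra \<open>B\<close>, the value of a
  term in \<open>B\<close> is the limit of the values of its approximants (\<open>ev_approx_converges\<close>), which makes
  \<open>ideal t \<mapsto> \<phi>(t)\<close> well defined and continuous (\<open>ex_hom_ideal_algebra\<close>).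

  A given free algebra is therefore homeomorphic to the algebra of ideals, and algebraicity is a
  topological invariant.\<close>

section \<open>The specialization order\<close>

lemma spec_le_refl: "x \<in> topspace X \<Longrightarrow> spec_le X x x"
  by (simp add: spec_le_iff)

lemma spec_le_trans: "spec_le X x y \<Longrightarrow> spec_le X y z \<Longrightarrow> spec_le X x z"
  by (simp add: spec_le_iff)

lemma spec_le_antisym: "t0_space X \<Longrightarrow> spec_le X x y \<Longrightarrow> spec_le X y x \<Longrightarrow> x = y"
  unfolding t0_space_def by (metis spec_le_iff)

lemma continuous_map_spec_le:
  assumes f: "continuous_map X Y f" and le: "spec_le X x y"
  shows "spec_le Y (f x) (f y)"
  unfolding spec_le_iff
proof (intro conjI allI impI)
  show "f x \<in> topspace Y" "f y \<in> topspace Y"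
    using f le by (auto simp: spec_le_iff continuous_map_def)
next
  fix U assume U: "openin Y U \<and> f x \<in> U"
  then have "openin X {z \<in> topspace X. f z \<in> U}"
    using f openin_continuous_map_preimage by blast
  then show "f y \<in> U"
    using le U by (auto simp: spec_le_iff)
qed

lemma spec_le_product:
  assumes "a \<in> topspace (product_topology X S)" "b \<in> topspace (product_topology X S)"
    and "\<And>k. k \<in> S \<Longrightarrow> spec_le (X k) (a k) (b k)"
  shows "spec_le (product_topology X S) a b"
  unfolding spec_le_iff
proof (intro conjI allI impI assms(1,2))
  fix U assume "openin (product_topology X S) U \<and> a \<in> U"
  then obtain V where V: "\<And>k. k \<in> S \<Longrightarrow> openin (X k) (V k)" "a \<in> Pi\<^sub>E S V" "Pi\<^sub>E S V \<subseteq> U"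
    unfolding openin_product_topology_alt by metis
  then have "b k \<in> V k" if "k \<in> S" for k
    using that assms(3)[of k] PiE_mem[OF V(2) that] by (auto simp: spec_le_iff)
  then have "b \<in> Pi\<^sub>E S V"
    using assms(2) by (auto simp: PiE_iff)
  then show "b \<in> U" using V(3) by blast
qed

lemma spec_le_dir_topology: "spec_le X x y \<Longrightarrow> spec_le (dir_topology X) x y"
  unfolding spec_le_iff[of "dir_topology X"] openin_dir_topology topspace_dir_topology
  using directed_open_upper by (metis spec_le_iff)

lemma topspace_dpower [simp]: "topspace (dpower X n) = {..<n} \<rightarrow>\<^sub>E topspace X"
  by (simp add: dpower_def)

text \<open>Passing to the directed-open topology of the product adds open sets but leaves the
  specialization order alone, since directed-open sets are upper sets.\<close>

lemma spec_le_dpower: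
  assumes "a \<in> {..<n} \<rightarrow>\<^sub>E topspace X" "b \<in> {..<n} \<rightarrow>\<^sub>E topspace X"
    and "\<And>k. k < n \<Longrightarrow> spec_le X (a k) (b k)"
  shows "spec_le (dpower X n) a b"
  unfolding dpower_def
  by (intro spec_le_dir_topology spec_le_product) (use assms in auto)

lemma continuous_map_dpower:
  "continuous_map (product_topology (\<lambda>_. X) {..<n}) Y f \<Longrightarrow> continuous_map (dpower X n) Y f"
  by (simp add: continuous_map_def dpower_def openin_dir_topology directed_open_if_openin)

section \<open>Algebraic spaces\<close>

text \<open>A directed set that converges to some \<open>y\<close> above \<open>k\<close> also converges to \<open>k\<close>, since the neighbourhoods
  of \<open>k\<close> contain \<open>y\<close>; so compactness of \<open>k\<close> makes its upper set directed-open.\<close>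

lemma openin_up_compact:
  assumes X: "directed_space X" and k: "k \<in> compact_elements X"
  shows "openin X {y. spec_le X k y}"
proof -
  have "directed_open X {y. spec_le X k y}"
    unfolding directed_open_def
  proof (intro conjI allI impI)
    show "{y. spec_le X k y} \<subseteq> topspace X" by (auto simp: spec_le_iff)
  next
    fix D x assume D: "directed_in X D \<and> converges_to X D x \<and> x \<in> {y. spec_le X k y}"
    then have "converges_to X D k"
      by (auto simp: converges_to_def spec_le_iff)
    then obtain d where "d \<in> D" "spec_le X k d"
      using D k unfolding compact_elements_def way_below_def by blast
    then show "D \<inter> {y. spec_le X k y} \<noteq> {}" by blast
  qed
  then show ?thesis using X by (simp add: directed_space_def)
qed

lemma compact_if_openin_up:
  assumes "k \<in> topspace X" "openin X {y. spec_le X k y}"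
  shows "k \<in> compact_elements X"
  unfolding compact_elements_def way_below_def
proof (intro CollectI conjI allI impI assms(1))
  fix D assume "directed_in X D \<and> converges_to X D k"
  then have "D \<inter> {y. spec_le X k y} \<noteq> {}"
    using assms spec_le_refl[of k X] unfolding converges_to_def by blast
  then show "\<exists>d\<in>D. spec_le X k d" by blast
qed

text \<open>A criterion in terms of a chosen basis \<open>B x\<close>. It suffices that \<open>B x\<close> itself is directed, because every
  compact element \<open>k\<close> below \<open>x\<close> is dominated by some member of \<open>B x\<close>: the set \<open>B x\<close> also converges to
  \<open>k\<close>. Hence the set of all compact elements below \<open>x\<close> inherits directedness and convergence from \<open>B x\<close>.
  The space is directed because a directed-open set containing \<open>x\<close> contains a whole open set
  \<open>{y. spec_le X b y}\<close> with \<open>b \<in> B x\<close>.\<close>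

lemma algebraic_spaceI:
  assumes t0: "t0_space X"
    and dirB: "\<And>x. x \<in> topspace X \<Longrightarrow> directed_in X (B x)"
    and convB: "\<And>x. x \<in> topspace X \<Longrightarrow> converges_to X (B x) x"
    and belowB: "\<And>x b. x \<in> topspace X \<Longrightarrow> b \<in> B x \<Longrightarrow> spec_le X b x"
    and openB: "\<And>x b. x \<in> topspace X \<Longrightarrow> b \<in> B x \<Longrightarrow> openin X {y. spec_le X b y}"
  shows "algebraic_space X"
  unfolding algebraic_space_def directed_space_def
proof (intro conjI allI impI ballI t0)
  fix U assume U: "directed_open X U"
  show "openin X U"
  proof (subst openin_subopen, intro ballI)
    fix x assume x: "x \<in> U"
    then have xX: "x \<in> topspace X" using U by (auto simp: directed_open_def)
    then obtain b where b: "b \<in> B x" "b \<in> U"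
      using U x dirB convB unfolding directed_open_def by blast
    show "\<exists>T. openin X T \<and> x \<in> T \<and> T \<subseteq> U"
      by (rule exI[of _ "{y. spec_le X b y}"])
        (use openB[OF xX b(1)] belowB[OF xX b(1)] directed_open_upper[OF U b(2)] in auto)
  qed
next
  fix x assume x: "x \<in> topspace X"
  let ?K = "{k \<in> compact_elements X. spec_le X k x}"
  have BK: "B x \<subseteq> ?K"
  proof
    fix b assume b: "b \<in> B x"
    then have "b \<in> compact_elements X"
      using dirB[OF x] openB[OF x b] by (intro compact_if_openin_up) (auto simp: directed_in_def)
    then show "b \<in> ?K" using belowB[OF x b] by simp
  qed
  have dom: "\<exists>b\<in>B x. spec_le X k b" if "k \<in> ?K" for k
  proof -
    have "converges_to X (B x) k"
      using that convB[OF x] by (auto simp: converges_to_def spec_le_iff)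
    then show ?thesis
      using that dirB[OF x] unfolding compact_elements_def way_below_def by blast
  qed
  show "directed_in X ?K"
    unfolding directed_in_def
  proof (intro conjI ballI)
    show "?K \<subseteq> topspace X" by (auto simp: spec_le_iff)
    show "?K \<noteq> {}" using BK dirB[OF x] unfolding directed_in_def by blast
  next
    fix a b assume "a \<in> ?K" "b \<in> ?K"
    then obtain a' b' where ab: "a' \<in> B x" "spec_le X a a'" "b' \<in> B x" "spec_le X b b'"
      using dom by meson
    then obtain c where "c \<in> B x" "spec_le X a' c" "spec_le X b' c"
      using dirB[OF x] unfolding directed_in_def by blast
    then show "\<exists>c\<in>?K. spec_le X a c \<and> spec_le X b c"
      using ab BK by (meson spec_le_trans subsetD)
  qed
  show "converges_to X ?K x"
    using convB[OF x] BK unfolding converges_to_def by blast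
qed

text \<open>The images of the compact elements below the corresponding point of \<open>X\<close> serve as a basis.\<close>

lemma algebraic_space_homeomorphic:
  assumes X: "algebraic_space X" and fg: "homeomorphic_maps X Y f g"
  shows "algebraic_space Y"
proof (rule algebraic_spaceI[where B = "\<lambda>y. f ` {k \<in> compact_elements X. spec_le X k (g y)}"])
  have f: "continuous_map X Y f" and g: "continuous_map Y X g"
    and gf: "\<And>x. x \<in> topspace X \<Longrightarrow> g (f x) = x" and fgy: "\<And>y. y \<in> topspace Y \<Longrightarrow> f (g y) = y"
    using fg unfolding homeomorphic_maps_def by auto
  have "X homeomorphic_space Y" using fg homeomorphic_space_def by blast
  then show "t0_space Y"
    using X homeomorphic_t0_space unfolding algebraic_space_def directed_space_def by blast
  fix y assume y: "y \<in> topspace Y"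
  then have gy: "g y \<in> topspace X" using g by (auto simp: continuous_map_def)
  let ?K = "{k \<in> compact_elements X. spec_le X k (g y)}"
  have K: "directed_in X ?K" "converges_to X ?K (g y)"
    using X gy unfolding algebraic_space_def by auto
  show "directed_in Y (f ` ?K)"
    unfolding directed_in_def
  proof (intro conjI ballI)
    show "f ` ?K \<subseteq> topspace Y"
      using f by (auto simp: continuous_map_def compact_elements_def)
    show "f ` ?K \<noteq> {}" using K(1) unfolding directed_in_def by blast
  next
    fix a b assume "a \<in> f ` ?K" "b \<in> f ` ?K"
    then obtain a' b' where ab: "a' \<in> ?K" "a = f a'" "b' \<in> ?K" "b = f b'" by blast
    then obtain c where "c \<in> ?K" "spec_le X a' c" "spec_le X b' c"
      using K(1) unfolding directed_in_def by blast
    then show "\<exists>c\<in>f ` ?K. spec_le Y a c \<and> spec_le Y b c"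
      using ab continuous_map_spec_le[OF f] by blast
  qed
  show "converges_to Y (f ` ?K) y"
    unfolding converges_to_def
  proof (intro conjI allI impI y)
    fix U assume U: "openin Y U \<and> y \<in> U"
    then have "openin X {x \<in> topspace X. f x \<in> U}" "g y \<in> {x \<in> topspace X. f x \<in> U}"
      using f gy fgy[OF y] openin_continuous_map_preimage by auto
    then have "?K \<inter> {x \<in> topspace X. f x \<in> U} \<noteq> {}"
      using K(2) unfolding converges_to_def by blast
    then show "f ` ?K \<inter> U \<noteq> {}" by blast
  qed
  fix d assume "d \<in> f ` ?K"
  then obtain k where k: "k \<in> ?K" "d = f k" by blast
  then have kX: "k \<in> topspace X" by (simp add: spec_le_iff)
  show "spec_le Y d y"
    using continuous_map_spec_le[OF f, of k "g y"] k fgy[OF y] by simp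
  have "spec_le Y d z \<longleftrightarrow> z \<in> topspace Y \<and> spec_le X k (g z)" for z
  proof
    assume "spec_le Y d z"
    then show "z \<in> topspace Y \<and> spec_le X k (g z)"
      using continuous_map_spec_le[OF g, of d z] k(2) gf[OF kX] spec_le_iff[of Y d z] by simp
  next
    assume "z \<in> topspace Y \<and> spec_le X k (g z)"
    then show "spec_le Y d z"
      using continuous_map_spec_le[OF f, of k "g z"] k(2) fgy[of z] by simp
  qed
  then have "{z. spec_le Y d z} = {z \<in> topspace Y. g z \<in> {x. spec_le X k x}}"
    by simp
  moreover have "openin X {x. spec_le X k x}"
    using X k(1) by (intro openin_up_compact) (auto simp: algebraic_space_def)
  then have "openin Y {z \<in> topspace Y. g z \<in> {x. spec_le X k x}}"
    by (rule openin_continuous_map_preimage[OF g])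
  ultimately show "openin Y {z. spec_le Y d z}" by simp
qed

section \<open>Spaces of ideals\<close>

text \<open>The Scott topology of the ideal completion, restricted to a family \<open>\<A>\<close> of ideals: the sets
  \<open>{J \<in> \<A>. p \<in> J}\<close> are a base.\<close>

definition ideal_topology :: "'p set set \<Rightarrow> 'p set topology" where
  "ideal_topology \<A> = topology (\<lambda>U. U \<subseteq> \<A> \<and> (\<forall>I\<in>U. \<exists>p\<in>I. \<forall>J\<in>\<A>. p \<in> J \<longrightarrow> J \<in> U))"

text \<open>Principal ideals are members of \<open>\<A>\<close>, hence down-closed; this makes \<open>le\<close> transitive on the elements
  of the ideals.\<close>

locale ideal_family =
  fixes le :: "'p \<Rightarrow> 'p \<Rightarrow> bool" and \<A> :: "'p set set"
  assumes nonempty: "I \<in> \<A> \<Longrightarrow> I \<noteq> {}"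
    and down: "I \<in> \<A> \<Longrightarrow> q \<in> I \<Longrightarrow> le p q \<Longrightarrow> p \<in> I"
    and dir: "I \<in> \<A> \<Longrightarrow> p \<in> I \<Longrightarrow> q \<in> I \<Longrightarrow> \<exists>r\<in>I. le p r \<and> le q r"
    and principal: "I \<in> \<A> \<Longrightarrow> p \<in> I \<Longrightarrow> {q. le q p} \<in> \<A>"
    and refl: "I \<in> \<A> \<Longrightarrow> p \<in> I \<Longrightarrow> le p p"
begin

lemma openin_ideal_topology:
  "openin (ideal_topology \<A>) U \<longleftrightarrow> U \<subseteq> \<A> \<and> (\<forall>I\<in>U. \<exists>p\<in>I. \<forall>J\<in>\<A>. p \<in> J \<longrightarrow> J \<in> U)"
proof -
  let ?open = "\<lambda>U. U \<subseteq> \<A> \<and> (\<forall>I\<in>U. \<exists>p\<in>I. \<forall>J\<in>\<A>. p \<in> J \<longrightarrow> J \<in> U)"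
  have "istopology ?open"
    unfolding istopology_def
  proof (intro conjI allI impI)
    fix S T assume S: "?open S" and T: "?open T"
    show "S \<inter> T \<subseteq> \<A>" using S by blast
    show "\<forall>I\<in>S \<inter> T. \<exists>p\<in>I. \<forall>J\<in>\<A>. p \<in> J \<longrightarrow> J \<in> S \<inter> T"
    proof
      fix I assume I: "I \<in> S \<inter> T"
      obtain p where p: "p \<in> I" "\<forall>J\<in>\<A>. p \<in> J \<longrightarrow> J \<in> S" using S I by blast
      obtain q where q: "q \<in> I" "\<forall>J\<in>\<A>. q \<in> J \<longrightarrow> J \<in> T" using T I by blast
      obtain r where "r \<in> I" "le p r" "le q r" using dir[of I p q] I S p q by blast
      then show "\<exists>p\<in>I. \<forall>J\<in>\<A>. p \<in> J \<longrightarrow> J \<in> S \<inter> T" using p q down by (meson IntI)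
    qed
  next
    fix \<K> assume "\<forall>K\<in>\<K>. ?open K"
    then show "\<Union>\<K> \<subseteq> \<A>" "\<forall>I\<in>\<Union>\<K>. \<exists>p\<in>I. \<forall>J\<in>\<A>. p \<in> J \<longrightarrow> J \<in> \<Union>\<K>"
      by (blast, meson UnionE UnionI)
  qed
  then show ?thesis
    unfolding ideal_topology_def by (simp add: topology_inverse')
qed

lemma openin_ideal_topologyD:
  "openin (ideal_topology \<A>) U \<Longrightarrow> I \<in> U \<Longrightarrow> \<exists>p\<in>I. \<forall>J\<in>\<A>. p \<in> J \<longrightarrow> J \<in> U"
  by (simp add: openin_ideal_topology)

lemma topspace_ideal_topology: "topspace (ideal_topology \<A>) = \<A>"
proof
  show "topspace (ideal_topology \<A>) \<subseteq> \<A>"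
    using openin_ideal_topology openin_topspace by blast
  have "openin (ideal_topology \<A>) \<A>"
    using nonempty unfolding openin_ideal_topology by blast
  then show "\<A> \<subseteq> topspace (ideal_topology \<A>)" by (rule openin_subset)
qed

lemma openin_containing: "openin (ideal_topology \<A>) {J \<in> \<A>. p \<in> J}"
  unfolding openin_ideal_topology by blast

text \<open>For inclusion, test specialization on the basic open sets \<open>{J \<in> \<A>. p \<in> J}\<close>, one for each \<open>p \<in> I\<close>.\<close>

lemma spec_le_ideal_topology:
  "spec_le (ideal_topology \<A>) I J \<longleftrightarrow> I \<in> \<A> \<and> J \<in> \<A> \<and> I \<subseteq> J"
proof
  assume le: "spec_le (ideal_topology \<A>) I J"
  then have "I \<in> \<A>" "J \<in> \<A>" by (auto simp: spec_le_iff topspace_ideal_topology)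
  moreover have "p \<in> J" if "p \<in> I" for p
    using le openin_containing[of p] that \<open>I \<in> \<A>\<close> unfolding spec_le_iff by blast
  ultimately show "I \<in> \<A> \<and> J \<in> \<A> \<and> I \<subseteq> J" by blast
next
  assume IJ: "I \<in> \<A> \<and> J \<in> \<A> \<and> I \<subseteq> J"
  have "J \<in> U" if "openin (ideal_topology \<A>) U" "I \<in> U" for U
    using that IJ unfolding openin_ideal_topology by (meson subsetD)
  then show "spec_le (ideal_topology \<A>) I J"
    using IJ unfolding spec_le_iff topspace_ideal_topology by simp
qed

text \<open>The principal ideals inside \<open>I\<close> form a basis at \<open>I\<close>: they are directed because \<open>I\<close> is, they
  converge to \<open>I\<close> because a neighbourhood of \<open>I\<close> is witnessed by one \<open>p \<in> I\<close>, and the upper set of the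
  principal ideal of \<open>p\<close> is the basic open set of all ideals containing \<open>p\<close>.\<close>

lemma algebraic_ideal_topology: "algebraic_space (ideal_topology \<A>)"
proof (rule algebraic_spaceI[where B = "\<lambda>I. (\<lambda>p. {q. le q p}) ` I"])
  show "t0_space (ideal_topology \<A>)"
    unfolding t0_space_def topspace_ideal_topology
  proof (intro ballI impI)
    fix I J assume IJ: "I \<in> \<A>" "J \<in> \<A>" "I \<noteq> J"
    then obtain p where "p \<in> I \<longleftrightarrow> p \<notin> J" by blast
    then show "\<exists>U. openin (ideal_topology \<A>) U \<and> (I \<notin> U \<longleftrightarrow> J \<in> U)"
      using IJ by (intro exI[of _ "{J \<in> \<A>. p \<in> J}"]) (auto simp: openin_containing)
  qed
  fix I assume "I \<in> topspace (ideal_topology \<A>)"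
  then have I: "I \<in> \<A>" by (simp add: topspace_ideal_topology)
  let ?D = "(\<lambda>p. {q. le q p}) ` I"
  have sub: "{q. le q p} \<subseteq> J \<longleftrightarrow> p \<in> J" if "p \<in> I" "J \<in> \<A>" for p J
    using that refl[OF I that(1)] down[OF that(2)] by blast
  show "directed_in (ideal_topology \<A>) ?D"
    unfolding directed_in_def topspace_ideal_topology
  proof (intro conjI ballI)
    show "?D \<subseteq> \<A>" "?D \<noteq> {}" using principal nonempty I by auto
  next
    fix a b assume "a \<in> ?D" "b \<in> ?D"
    then obtain p q where pq: "p \<in> I" "q \<in> I" "a = {r. le r p}" "b = {r. le r q}"
      by blast
    obtain r where r: "r \<in> I" "le p r" "le q r" using dir[OF I pq(1,2)] by blast
    then show "\<exists>c\<in>?D. spec_le (ideal_topology \<A>) a c \<and> spec_le (ideal_topology \<A>) b c"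
      using pq principal[OF I] sub unfolding spec_le_ideal_topology
      by (intro bexI[of _ "{q. le q r}"]) auto
  qed
  show "converges_to (ideal_topology \<A>) ?D I"
    unfolding converges_to_def topspace_ideal_topology openin_ideal_topology
  proof (intro conjI allI impI I)
    fix U assume U: "(U \<subseteq> \<A> \<and> (\<forall>I\<in>U. \<exists>p\<in>I. \<forall>J\<in>\<A>. p \<in> J \<longrightarrow> J \<in> U)) \<and> I \<in> U"
    then obtain p where p: "p \<in> I" "\<forall>J\<in>\<A>. p \<in> J \<longrightarrow> J \<in> U" by blast
    then have "{q. le q p} \<in> U" using principal[OF I p(1)] refl[OF I p(1)] by simp
    moreover have "{q. le q p} \<in> ?D" using p(1) by (rule imageI)
    ultimately show "?D \<inter> U \<noteq> {}" by blast
  qed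
  fix d assume "d \<in> ?D"
  then obtain p where p: "p \<in> I" "d = {q. le q p}" by blast
  then have "d \<in> \<A>" using principal[OF I] by blast
  then have up: "spec_le (ideal_topology \<A>) d J \<longleftrightarrow> J \<in> \<A> \<and> p \<in> J" for J
    using sub[OF p(1)] p(2) unfolding spec_le_ideal_topology by blast
  show "spec_le (ideal_topology \<A>) d I"
    using up I p(1) by blast
  show "openin (ideal_topology \<A>) {J. spec_le (ideal_topology \<A>) d J}"
    using openin_containing[of p] by (simp add: up)
qed

end

section \<open>Terms and homomorphisms\<close>

primrec subst :: "('v \<Rightarrow> ('i, 'x) trm) \<Rightarrow> ('i, 'v) trm \<Rightarrow> ('i, 'x) trm" where
  "subst \<sigma> (Var v) = \<sigma> v"
| "subst \<sigma> (App i ts) = App i (map (subst \<sigma>) ts)"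

lemma subst_Var: "subst Var t = t"
  by (induction t) (simp_all add: map_idI)

lemma sig_terms_AppI:
  "i \<in> symbols \<Sigma> \<Longrightarrow> length ts = arity \<Sigma> i \<Longrightarrow> (\<And>k. k < arity \<Sigma> i \<Longrightarrow> ts ! k \<in> sig_terms \<Sigma> V)
    \<Longrightarrow> App i ts \<in> sig_terms \<Sigma> V"
  by (rule sig_terms.App) (auto simp: all_set_conv_all_nth)

lemma sig_terms_nth:
  "App i ts \<in> sig_terms \<Sigma> V \<Longrightarrow> k < arity \<Sigma> i \<Longrightarrow> ts ! k \<in> sig_terms \<Sigma> V"
  by (auto elim: sig_terms.cases)

lemma subst_in_sig_terms:
  assumes "\<tau> \<in> sig_terms \<Sigma> W" and "\<And>v. v \<in> W \<Longrightarrow> \<sigma> v \<in> sig_terms \<Sigma> V"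
  shows "subst \<sigma> \<tau> \<in> sig_terms \<Sigma> V"
  using assms(1) by induction (auto intro!: assms(2) sig_terms.App)

lemma eval_trm_App:
  "eval_trm f h (App i ts) = f i (\<lambda>k\<in>{..<length ts}. eval_trm f h (ts ! k))"
  by (auto intro!: arg_cong[of _ _ "f i"] restrict_ext)

lemma eval_trm_subst:
  "eval_trm f h (subst \<sigma> \<tau>) = eval_trm f (\<lambda>v. eval_trm f h (\<sigma> v)) \<tau>"
proof (induction \<tau>)
  case (App i ts)
  then have "map (eval_trm f h) (map (subst \<sigma>) ts) = map (eval_trm f (\<lambda>v. eval_trm f h (\<sigma> v))) ts"
    by auto
  then show ?case by (simp only: subst.simps eval_trm.simps length_map)
qed simp

lemma eval_trm_cong:
  assumes "t \<in> sig_terms \<Sigma> V" and "\<And>v. v \<in> V \<Longrightarrow> h v = h' v"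
  shows "eval_trm f h t = eval_trm f h' t"
  using assms(1)
proof induction
  case (App i ts)
  then have "map (eval_trm f h) ts = map (eval_trm f h') ts" by auto
  then show ?case by (simp only: eval_trm.simps)
qed (simp add: assms(2))

lemma alg_op_closed:
  assumes "dtop_algebra \<Sigma> B" "i \<in> symbols \<Sigma>" "a \<in> {..<arity \<Sigma> i} \<rightarrow>\<^sub>E topspace (alg_space B)"
  shows "alg_op B i a \<in> topspace (alg_space B)"
proof -
  have "continuous_map (dpower (alg_space B) (arity \<Sigma> i)) (alg_space B) (alg_op B i)"
    using assms(1,2) by (simp add: dtop_algebra_def)
  then show ?thesis
    using assms(3) continuous_map_funspace by fastforce
qed

text \<open>Continuity of the operations on the power implies monotonicity, since the specialization
  order of the power is componentwise.\<close>

lemma alg_op_mono: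
  assumes B: "dtop_algebra \<Sigma> B" "i \<in> symbols \<Sigma>"
    and le: "\<And>k. k < arity \<Sigma> i \<Longrightarrow> spec_le (alg_space B) (a k) (b k)"
  shows "spec_le (alg_space B) (alg_op B i (\<lambda>k\<in>{..<arity \<Sigma> i}. a k))
    (alg_op B i (\<lambda>k\<in>{..<arity \<Sigma> i}. b k))"
proof (rule continuous_map_spec_le[where f = "alg_op B i"])
  show "continuous_map (dpower (alg_space B) (arity \<Sigma> i)) (alg_space B) (alg_op B i)"
    using B by (simp add: dtop_algebra_def)
  show "spec_le (dpower (alg_space B) (arity \<Sigma> i)) (\<lambda>k\<in>{..<arity \<Sigma> i}. a k) (\<lambda>k\<in>{..<arity \<Sigma> i}. b k)"
    by (rule spec_le_dpower) (use le in \<open>auto simp: spec_le_iff\<close>)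
qed

lemma eval_trm_closed:
  assumes B: "dtop_algebra \<Sigma> B" and t: "t \<in> sig_terms \<Sigma> V"
    and h: "\<And>v. v \<in> V \<Longrightarrow> h v \<in> topspace (alg_space B)"
  shows "eval_trm (alg_op B) h t \<in> topspace (alg_space B)"
  using t
proof induction
  case (App i ts)
  then have "(\<lambda>k\<in>{..<length ts}. eval_trm (alg_op B) h (ts ! k)) \<in> {..<arity \<Sigma> i} \<rightarrow>\<^sub>E topspace (alg_space B)"
    by auto
  then show ?case
    unfolding eval_trm_App using alg_op_closed[OF B App(1)] by blast
qed (simp add: h)

lemma dtop_hom_eval_trm:
  assumes g: "dtop_hom \<Sigma> A B g" and A: "dtop_algebra \<Sigma> A" and t: "t \<in> sig_terms \<Sigma> V"
    and h: "\<And>v. v \<in> V \<Longrightarrow> h v \<in> topspace (alg_space A)"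
  shows "g (eval_trm (alg_op A) h t) = eval_trm (alg_op B) (\<lambda>v. g (h v)) t"
  using t
proof induction
  case (App i ts)
  let ?a = "\<lambda>k\<in>{..<arity \<Sigma> i}. eval_trm (alg_op A) h (ts ! k)"
  have "?a \<in> {..<arity \<Sigma> i} \<rightarrow>\<^sub>E topspace (alg_space A)"
    using App by (auto intro!: eval_trm_closed[OF A _ h])
  then have "g (alg_op A i ?a) = alg_op B i (\<lambda>k\<in>{..<arity \<Sigma> i}. g (?a k))"
    using g App(1) by (simp add: dtop_hom_def)
  also have "(\<lambda>k\<in>{..<arity \<Sigma> i}. g (?a k)) = (\<lambda>k\<in>{..<arity \<Sigma> i}. eval_trm (alg_op B) (\<lambda>v. g (h v)) (ts ! k))"
    using App by (intro restrict_ext) auto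
  finally show ?case
    using App(2) by (simp only: eval_trm_App)
qed simp

lemma dtop_hom_id:
  assumes "dtop_algebra \<Sigma> A"
  shows "dtop_hom \<Sigma> A A (\<lambda>a. a)"
  unfolding dtop_hom_def
proof (intro conjI ballI)
  fix i a assume "a \<in> {..<arity \<Sigma> i} \<rightarrow>\<^sub>E topspace (alg_space A)"
  then have "(\<lambda>k\<in>{..<arity \<Sigma> i}. a k) = a"
    by (rule PiE_restrict)
  then show "alg_op A i a = alg_op A i (\<lambda>k\<in>{..<arity \<Sigma> i}. a k)" by simp
qed simp

lemma dtop_hom_compose:
  assumes f: "dtop_hom \<Sigma> A B f" and g: "dtop_hom \<Sigma> B C g"
  shows "dtop_hom \<Sigma> A C (\<lambda>a. g (f a))"
  unfolding dtop_hom_def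
proof (intro conjI ballI)
  have cf: "continuous_map (alg_space A) (alg_space B) f" and cg: "continuous_map (alg_space B) (alg_space C) g"
    using f g by (auto simp: dtop_hom_def)
  show "continuous_map (alg_space A) (alg_space C) (\<lambda>a. g (f a))"
    using continuous_map_compose[OF cf cg] by (simp add: comp_def)
  fix i a assume i: "i \<in> symbols \<Sigma>" and a: "a \<in> {..<arity \<Sigma> i} \<rightarrow>\<^sub>E topspace (alg_space A)"
  have f_op: "f (alg_op A i a) = alg_op B i (\<lambda>k\<in>{..<arity \<Sigma> i}. f (a k))"
    using f i a by (simp add: dtop_hom_def)
  have "(\<lambda>k\<in>{..<arity \<Sigma> i}. f (a k)) \<in> {..<arity \<Sigma> i} \<rightarrow>\<^sub>E topspace (alg_space B)"
    using a cf by (auto simp: continuous_map_def PiE_iff)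
  then have "g (alg_op B i (\<lambda>k\<in>{..<arity \<Sigma> i}. f (a k)))
      = alg_op C i (\<lambda>k\<in>{..<arity \<Sigma> i}. g ((\<lambda>k\<in>{..<arity \<Sigma> i}. f (a k)) k))"
    using g i by (simp add: dtop_hom_def)
  also have "(\<lambda>k\<in>{..<arity \<Sigma> i}. g ((\<lambda>k\<in>{..<arity \<Sigma> i}. f (a k)) k)) = (\<lambda>k\<in>{..<arity \<Sigma> i}. g (f (a k)))"
    by (intro restrict_ext) simp
  finally show "g (f (alg_op A i a)) = alg_op C i (\<lambda>k\<in>{..<arity \<Sigma> i}. g (f (a k)))"
    unfolding f_op .
qed

lemma universal_for_unique:
  fixes B :: "('i, 'b) top_alg"
  assumes univ: "universal_for TYPE('b) \<Sigma> E X A \<eta>"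
    and B: "dtop_obj \<Sigma> E B" and \<phi>: "continuous_map X (alg_space B) \<phi>"
    and g: "dtop_hom \<Sigma> A B g" "\<And>x. x \<in> topspace X \<Longrightarrow> g (\<eta> x) = \<phi> x"
    and h: "dtop_hom \<Sigma> A B h" "\<And>x. x \<in> topspace X \<Longrightarrow> h (\<eta> x) = \<phi> x"
    and a: "a \<in> topspace (alg_space A)"
  shows "g a = h a"
proof -
  have "\<exists>e. dtop_hom \<Sigma> A B e \<and> (\<forall>x\<in>topspace X. e (\<eta> x) = \<phi> x) \<and>
      (\<forall>e'. dtop_hom \<Sigma> A B e' \<and> (\<forall>x\<in>topspace X. e' (\<eta> x) = \<phi> x) \<longrightarrow>
        (\<forall>a\<in>topspace (alg_space A). e' a = e a))"
    using univ[unfolded universal_for_def, rule_format, of B \<phi>] B \<phi> by blast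
  then obtain e where e: "\<forall>e'. dtop_hom \<Sigma> A B e' \<and> (\<forall>x\<in>topspace X. e' (\<eta> x) = \<phi> x) \<longrightarrow>
      (\<forall>a\<in>topspace (alg_space A). e' a = e a)"
    by (elim exE conjE)
  have "g a = e a" using e[rule_format, of g a] g a by simp
  moreover have "h a = e a" using e[rule_format, of h a] h a by simp
  ultimately show ?thesis by simp
qed

section \<open>Inequalities between terms and approximation by compact terms\<close>

locale algebraic_generators =
  fixes \<Sigma> :: "'i signature"
    and E :: "(('i, nat) trm \<times> ('i, nat) trm) set"
    and X :: "'x topology"
  assumes E: "E \<subseteq> sig_terms \<Sigma> UNIV \<times> sig_terms \<Sigma> UNIV"
    and X: "algebraic_space X"
begin

abbreviation X_terms :: "('i, 'x) trm set" where
  "X_terms \<equiv> sig_terms \<Sigma> (topspace X)"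

abbreviation K_terms :: "('i, 'x) trm set" where
  "K_terms \<equiv> sig_terms \<Sigma> (compact_elements X)"

text \<open>The free ordered \<open>\<Sigma>\<close>-algebra satisfying \<open>E\<close> over the poset of compact elements, presented as a
  preorder on terms.\<close>

inductive le :: "('i, 'x) trm \<Rightarrow> ('i, 'x) trm \<Rightarrow> bool" where
  le_Var: "k \<in> compact_elements X \<Longrightarrow> l \<in> compact_elements X \<Longrightarrow> spec_le X k l \<Longrightarrow> le (Var k) (Var l)"
| le_App: "i \<in> symbols \<Sigma> \<Longrightarrow> length ps = arity \<Sigma> i \<Longrightarrow> length qs = arity \<Sigma> i \<Longrightarrow>
    \<forall>k<arity \<Sigma> i. le (ps ! k) (qs ! k) \<Longrightarrow> le (App i ps) (App i qs)"
| le_ineq: "(\<tau>\<^sub>1, \<tau>\<^sub>2) \<in> E \<Longrightarrow> \<forall>v. \<sigma> v \<in> K_terms \<Longrightarrow> le (subst \<sigma> \<tau>\<^sub>1) (subst \<sigma> \<tau>\<^sub>2)"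
| le_refl: "p \<in> K_terms \<Longrightarrow> le p p"
| le_trans: "le p q \<Longrightarrow> le q r \<Longrightarrow> le p r"

lemma le_K_terms: "le p q \<Longrightarrow> p \<in> K_terms \<and> q \<in> K_terms"
proof (induction rule: le.induct)
  case (le_ineq \<tau>\<^sub>1 \<tau>\<^sub>2 \<sigma>)
  then show ?case using E by (auto intro!: subst_in_sig_terms)
qed (auto intro: sig_terms.Var sig_terms_AppI)

lemma le_subst:
  assumes "\<tau> \<in> sig_terms \<Sigma> UNIV" and "\<And>v. le (\<sigma> v) (\<sigma>' v)"
  shows "le (subst \<sigma> \<tau>) (subst \<sigma>' \<tau>)"
  using assms(1)
proof induction
  case (App i ts)
  then show ?case by (auto intro!: le_App)
qed (simp add: assms(2))

text \<open>An approximant has the shape of \<open>t\<close>; only its leaves are lowered to compact elements. Keeping the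
  shape fixed is what makes directedness and the passage through operations a matter of
  single leaves.\<close>

inductive approx :: "('i, 'x) trm \<Rightarrow> ('i, 'x) trm \<Rightarrow> bool" where
  approx_Var: "k \<in> compact_elements X \<Longrightarrow> spec_le X k x \<Longrightarrow> approx (Var k) (Var x)"
| approx_App: "i \<in> symbols \<Sigma> \<Longrightarrow> length ps = arity \<Sigma> i \<Longrightarrow> length ts = arity \<Sigma> i \<Longrightarrow>
    \<forall>k<arity \<Sigma> i. approx (ps ! k) (ts ! k) \<Longrightarrow> approx (App i ps) (App i ts)"

inductive_cases approx_to_Var: "approx p (Var x)"
inductive_cases approx_to_App: "approx p (App i ts)"

lemma approx_K_terms: "approx p t \<Longrightarrow> p \<in> K_terms"
  by (induction rule: approx.induct) (auto intro: sig_terms.Var sig_terms_AppI)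

lemma ex_compact_below: "x \<in> topspace X \<Longrightarrow> \<exists>k\<in>compact_elements X. spec_le X k x"
  using X unfolding algebraic_space_def directed_in_def by blast

lemma compact_below_directed:
  assumes "k \<in> compact_elements X" "spec_le X k x" "l \<in> compact_elements X" "spec_le X l x"
  shows "\<exists>m\<in>compact_elements X. spec_le X m x \<and> spec_le X k m \<and> spec_le X l m"
proof -
  have "directed_in X {k \<in> compact_elements X. spec_le X k x}"
    using X assms(2) by (simp add: algebraic_space_def spec_le_iff[of X k x])
  then show ?thesis
    using assms unfolding directed_in_def by blast
qed

lemma ex_approx: "t \<in> X_terms \<Longrightarrow> \<exists>p. approx p t"
proof (induction rule: sig_terms.induct)
  case (Var x)
  then show ?case using ex_compact_below approx_Var by blast
next
  case (App i ts)
  then obtain c where "\<forall>t\<in>set ts. approx (c t) t" by metis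
  then have "approx (App i (map c ts)) (App i ts)"
    using App by (intro approx_App) auto
  then show ?case by blast
qed

text \<open>Upper bounds are formed leaf by leaf, using that the compact elements below a point of
  \<open>X\<close> are directed.\<close>

lemma approx_directed:
  "approx p t \<Longrightarrow> approx q t \<Longrightarrow> \<exists>r. approx r t \<and> le p r \<and> le q r"
proof (induction arbitrary: q rule: approx.induct)
  case (approx_Var k x)
  obtain l where l: "q = Var l" "l \<in> compact_elements X" "spec_le X l x"
    using approx_Var(3) by (rule approx_to_Var) auto
  then obtain m where m: "m \<in> compact_elements X" "spec_le X m x" "spec_le X k m" "spec_le X l m"
    using compact_below_directed approx_Var by blast
  then have "approx (Var m) (Var x)" "le (Var k) (Var m)" "le (Var l) (Var m)"
    using approx_Var l by (auto intro: approx.approx_Var le_Var)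
  then show ?case using l(1) by blast
next
  case (approx_App i ps ts)
  obtain qs where qs: "q = App i qs" "length qs = arity \<Sigma> i"
    "\<forall>k<arity \<Sigma> i. approx (qs ! k) (ts ! k)"
    using approx_App(5) by (rule approx_to_App) auto
  then have "\<forall>k<arity \<Sigma> i. \<exists>r. approx r (ts ! k) \<and> le (ps ! k) r \<and> le (qs ! k) r"
    using approx_App(4) by blast
  then obtain c where c: "\<forall>k<arity \<Sigma> i. approx (c k) (ts ! k) \<and> le (ps ! k) (c k) \<and> le (qs ! k) (c k)"
    by metis
  let ?r = "App i (map c [0..<arity \<Sigma> i])"
  have "approx ?r (App i ts)" "le (App i ps) ?r" "le (App i qs) ?r"
    using approx_App c qs by (auto intro!: approx.approx_App le_App)
  then show ?case using qs(1) by blast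
qed

lemma approx_refl: "p \<in> K_terms \<Longrightarrow> approx p p"
proof (induction rule: sig_terms.induct)
  case (Var k)
  then show ?case by (auto intro!: approx_Var spec_le_refl simp: compact_elements_def)
qed (auto intro!: approx_App)

lemma approx_imp_le: "approx p q \<Longrightarrow> q \<in> K_terms \<Longrightarrow> le p q"
proof (induction rule: approx.induct)
  case (approx_Var k x)
  then show ?case by (auto intro: le_Var elim: sig_terms.cases)
next
  case (approx_App i ps ts)
  then show ?case by (auto intro!: le_App dest: sig_terms_nth)
qed

lemma approx_subst:
  assumes "\<tau> \<in> sig_terms \<Sigma> UNIV" and "\<And>v. approx (\<sigma> v) (s v)"
  shows "approx (subst \<sigma> \<tau>) (subst s \<tau>)"
  using assms(1)
proof induction
  case (App i ts)
  then show ?case by (auto intro!: approx_App)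
qed (simp add: assms(2))

lemma approx_directed_finite:
  assumes t: "t \<in> X_terms" and fin: "finite P" and P: "\<And>p. p \<in> P \<Longrightarrow> approx p t"
  shows "\<exists>r. approx r t \<and> (\<forall>p\<in>P. le p r)"
  using fin P
proof (induction P)
  case empty
  then show ?case using ex_approx[OF t] by blast
next
  case (insert p P)
  then obtain q where q: "approx q t" "\<forall>p\<in>P. le p q" by blast
  then obtain r where "approx r t" "le p r" "le q r"
    using approx_directed insert.prems by blast
  then show ?case using q le_trans by blast
qed

text \<open>A variable may occur several times in \<open>\<tau>\<close>, and an approximant of \<open>subst s \<tau>\<close> may lower these
  occurrences differently, so it need not be an instance of \<open>\<tau>\<close>, and the inequalities \<open>E\<close> do not apply to
  it directly. As only finitely many occurrences are involved, directedness yields a common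
  approximant for each variable, at the price of going up in \<open>le\<close>.\<close>

lemma approx_subst_cofinal:
  assumes "\<tau> \<in> sig_terms \<Sigma> UNIV" and s: "\<And>v. s v \<in> X_terms" and "approx p (subst s \<tau>)"
  shows "\<exists>\<sigma>. (\<forall>v. approx (\<sigma> v) (s v)) \<and> le p (subst \<sigma> \<tau>)"
  using assms(1,3)
proof (induction arbitrary: p)
  case (Var v)
  obtain c where c: "\<And>v. approx (c v) (s v)" using ex_approx[OF s] by metis
  \<comment> \<open>The values of the substitution off \<open>v\<close> only have to be some approximants.\<close>
  show ?case
    using Var c by (intro exI[of _ "c(v := p)"]) (auto intro: le_refl approx_K_terms)
next
  case (App i ts)
  obtain ps where ps: "p = App i ps" "length ps = arity \<Sigma> i"
    "\<forall>k<arity \<Sigma> i. approx (ps ! k) (subst s (ts ! k))"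
    using App(4) App(2) by (auto elim: approx_to_App)
  have "\<exists>\<sigma>. (\<forall>v. approx (\<sigma> v) (s v)) \<and> le (ps ! k) (subst \<sigma> (ts ! k))" if "k < arity \<Sigma> i" for k
    using App(2,3) ps that by auto
  then obtain \<sigma> where \<sigma>: "\<And>k v. k < arity \<Sigma> i \<Longrightarrow> approx (\<sigma> k v) (s v)"
      "\<And>k. k < arity \<Sigma> i \<Longrightarrow> le (ps ! k) (subst (\<sigma> k) (ts ! k))"
    by metis
  have "\<exists>r. approx r (s v) \<and> (\<forall>q\<in>(\<lambda>k. \<sigma> k v) ` {..<arity \<Sigma> i}. le q r)" for v
    by (rule approx_directed_finite) (use \<sigma> s in auto)
  then obtain \<rho> where \<rho>: "\<And>v. approx (\<rho> v) (s v)" "\<And>k v. k < arity \<Sigma> i \<Longrightarrow> le (\<sigma> k v) (\<rho> v)"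
    by (metis imageI lessThan_iff)
  have "le (ps ! k) (subst \<rho> (ts ! k))" if "k < arity \<Sigma> i" for k
    using that App(2,3) \<sigma>(2) \<rho>(2) by (intro le_trans[OF \<sigma>(2) le_subst]) auto
  then have "le p (subst \<rho> (App i ts))"
    using App ps by (auto intro!: le_App)
  then show ?case using \<rho>(1) by blast
qed

section \<open>The free algebra\<close>

definition ideal :: "('i, 'x) trm \<Rightarrow> ('i, 'x) trm set" where
  "ideal t = {p. \<exists>q. approx q t \<and> le p q}"

text \<open>Defined without choosing terms that represent the ideals, so that it is independent of
  representatives and visibly depends on finitely many elements of the arguments.\<close>

definition ideal_op :: "'i \<Rightarrow> (nat \<Rightarrow> ('i, 'x) trm set) \<Rightarrow> ('i, 'x) trm set" where
  "ideal_op i a = {p. \<exists>ps. length ps = arity \<Sigma> i \<and> (\<forall>k<arity \<Sigma> i. ps ! k \<in> a k) \<and> le p (App i ps)}"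

definition ideal_algebra :: "('i, ('i, 'x) trm set) top_alg" where
  "ideal_algebra = \<lparr>alg_space = ideal_topology (ideal ` X_terms), alg_op = ideal_op\<rparr>"

lemma ideal_K_term: "p \<in> K_terms \<Longrightarrow> ideal p = {q. le q p}"
  unfolding ideal_def using approx_refl approx_imp_le le_trans by blast

lemma approx_in_ideal: "approx p t \<Longrightarrow> p \<in> ideal t"
  unfolding ideal_def using le_refl approx_K_terms by blast

lemma K_terms_subset: "K_terms \<subseteq> X_terms"
proof
  fix p assume "p \<in> K_terms"
  then show "p \<in> X_terms"
    by induction (auto intro: sig_terms.intros simp: compact_elements_def)
qed

text \<open>Every element of an ideal is a term over compact elements, and such a term generates
  its own principal ideal; so all principal ideals belong to the family.\<close>

sublocale ideal_family le "ideal ` X_terms"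
proof
  fix I p assume "I \<in> ideal ` X_terms" "p \<in> I"
  then have p: "p \<in> K_terms" unfolding ideal_def using le_K_terms by blast
  then show "le p p" by (rule le_refl)
  show "{q. le q p} \<in> ideal ` X_terms"
    using p K_terms_subset ideal_K_term[OF p] by blast
next
  fix I assume "I \<in> ideal ` X_terms"
  then show "I \<noteq> {}" using ex_approx approx_in_ideal by blast
next
  fix I p q assume "I \<in> ideal ` X_terms" "q \<in> I" "le p q"
  then show "p \<in> I" unfolding ideal_def using le_trans by blast
next
  fix I p q assume "I \<in> ideal ` X_terms" "p \<in> I" "q \<in> I"
  then obtain t p' q' where *: "I = ideal t" "approx p' t" "le p p'" "approx q' t" "le q q'"
    unfolding ideal_def by blast
  then obtain r where "approx r t" "le p' r" "le q' r" using approx_directed by blast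
  then show "\<exists>r\<in>I. le p r \<and> le q r" using * approx_in_ideal le_trans by blast
qed

lemma topspace_ideal_algebra [simp]: "topspace (alg_space ideal_algebra) = ideal ` X_terms"
  by (simp add: ideal_algebra_def topspace_ideal_topology)

text \<open>Approximants of a compound term are exactly the tuples of approximants of its arguments. Thus
  \<open>ideal\<close> is a homomorphism from the term algebra.\<close>

lemma ideal_op_ideal:
  assumes i: "i \<in> symbols \<Sigma>" and ts: "length ts = arity \<Sigma> i"
  shows "ideal_op i (\<lambda>k\<in>{..<arity \<Sigma> i}. ideal (ts ! k)) = ideal (App i ts)"
proof (intro set_eqI iffI)
  fix p assume "p \<in> ideal_op i (\<lambda>k\<in>{..<arity \<Sigma> i}. ideal (ts ! k))"
  then obtain ps where ps: "length ps = arity \<Sigma> i" "le p (App i ps)"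
    "\<forall>k<arity \<Sigma> i. \<exists>q. approx q (ts ! k) \<and> le (ps ! k) q"
    unfolding ideal_op_def ideal_def by auto
  then obtain c where c: "\<forall>k<arity \<Sigma> i. approx (c k) (ts ! k) \<and> le (ps ! k) (c k)" by metis
  let ?q = "App i (map c [0..<arity \<Sigma> i])"
  have "approx ?q (App i ts)" "le (App i ps) ?q"
    using c i ts ps(1) by (auto intro!: approx_App le_App)
  then show "p \<in> ideal (App i ts)"
    using ps(2) le_trans unfolding ideal_def by blast
next
  fix p assume "p \<in> ideal (App i ts)"
  then obtain q where q: "approx q (App i ts)" "le p q" unfolding ideal_def by blast
  from q(1) obtain ps where ps: "q = App i ps" "length ps = arity \<Sigma> i"
    "\<forall>k<arity \<Sigma> i. approx (ps ! k) (ts ! k)"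
    by (rule approx_to_App) auto
  then show "p \<in> ideal_op i (\<lambda>k\<in>{..<arity \<Sigma> i}. ideal (ts ! k))"
    using q(2) approx_in_ideal unfolding ideal_op_def by auto
qed

lemma eval_ideal_algebra:
  assumes "\<tau> \<in> sig_terms \<Sigma> V" and "\<And>v. v \<in> V \<Longrightarrow> h v = ideal (s v)"
  shows "eval_trm (alg_op ideal_algebra) h \<tau> = ideal (subst s \<tau>)"
  using assms(1)
proof induction
  case (App i ts)
  have "(\<lambda>k\<in>{..<arity \<Sigma> i}. eval_trm (alg_op ideal_algebra) h (ts ! k))
      = (\<lambda>k\<in>{..<arity \<Sigma> i}. ideal (map (subst s) ts ! k))"
    using App by (intro restrict_ext) auto
  then show ?case
    using App(1,2) ideal_op_ideal[of i "map (subst s) ts"]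
    by (simp add: eval_trm_App ideal_algebra_def del: eval_trm.simps)
qed (simp add: assms(2))

lemma algebraic_space_ideal_algebra: "algebraic_space (alg_space ideal_algebra)"
  using algebraic_ideal_topology by (simp add: ideal_algebra_def)

lemma tuple_of_ideals:
  assumes a: "a \<in> {..<n} \<rightarrow>\<^sub>E ideal ` X_terms"
  obtains ts where "length ts = n" "\<forall>k<n. ts ! k \<in> X_terms"
    "a = (\<lambda>k\<in>{..<n}. ideal (ts ! k))"
proof -
  have "\<forall>k<n. \<exists>t\<in>X_terms. a k = ideal t" using a by auto
  then obtain t where t: "\<forall>k<n. t k \<in> X_terms \<and> a k = ideal (t k)" by metis
  let ?ts = "map t [0..<n]"
  have "a = (\<lambda>k\<in>{..<n}. ideal (?ts ! k))"
  proof
    fix k show "a k = (\<lambda>k\<in>{..<n}. ideal (?ts ! k)) k"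
      using t PiE_arb[OF a, of k] by (cases "k < n") simp_all
  qed
  then show thesis
    using t by (intro that[of ?ts]) simp_all
qed

text \<open>If \<open>p \<in> ideal_op i a\<close> is witnessed by the terms \<open>ps\<close>, then the same \<open>ps\<close> witness \<open>p \<in> ideal_op i b\<close> for
  every \<open>b\<close> in the open box of tuples with \<open>ps ! k \<in> b k\<close>.\<close>

lemma continuous_map_ideal_op:
  assumes i: "i \<in> symbols \<Sigma>"
  shows "continuous_map (dpower (alg_space ideal_algebra) (arity \<Sigma> i)) (alg_space ideal_algebra) (ideal_op i)"
proof (rule continuous_map_dpower)
  let ?n = "arity \<Sigma> i" and ?T = "ideal_topology (ideal ` X_terms)"
  let ?P = "product_topology (\<lambda>_. ?T) {..<?n}"
  have closed: "ideal_op i a \<in> ideal ` X_terms" if "a \<in> {..<?n} \<rightarrow>\<^sub>E ideal ` X_terms" for a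
  proof -
    from that obtain ts where ts: "length ts = ?n" "\<forall>k<?n. ts ! k \<in> X_terms"
      "a = (\<lambda>k\<in>{..<?n}. ideal (ts ! k))"
      by (rule tuple_of_ideals) blast
    then have "ideal_op i a = ideal (App i ts)"
      using ideal_op_ideal[OF i, of ts] by simp
    moreover have "App i ts \<in> X_terms" using ts i by (intro sig_terms_AppI) simp_all
    ultimately show ?thesis by blast
  qed
  have "continuous_map ?P ?T (ideal_op i)"
    unfolding continuous_map_def
  proof (intro conjI allI impI)
    show "ideal_op i \<in> topspace ?P \<rightarrow> topspace ?T"
      using closed by (auto simp: topspace_ideal_topology)
    fix U assume U: "openin ?T U"
    show "openin ?P {a \<in> topspace ?P. ideal_op i a \<in> U}"
    proof (subst openin_subopen, intro ballI)
      fix a assume "a \<in> {a \<in> topspace ?P. ideal_op i a \<in> U}"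
      then have a: "a \<in> {..<?n} \<rightarrow>\<^sub>E ideal ` X_terms" "ideal_op i a \<in> U"
        by (auto simp: topspace_ideal_topology)
      from openin_ideal_topologyD[OF U a(2)] obtain p where p: "p \<in> ideal_op i a"
        "\<And>J. J \<in> ideal ` X_terms \<Longrightarrow> p \<in> J \<Longrightarrow> J \<in> U"
        by metis
      then obtain ps where ps: "length ps = ?n" "\<forall>k<?n. ps ! k \<in> a k" "le p (App i ps)"
        unfolding ideal_op_def by blast
      let ?B = "\<Pi>\<^sub>E k\<in>{..<?n}. {J \<in> ideal ` X_terms. ps ! k \<in> J}"
      have "openin ?P ?B"
        using openin_containing by (simp add: openin_PiE_gen)
      moreover have "a \<in> ?B" using a(1) ps(2) by (auto simp: PiE_iff)
      moreover have "?B \<subseteq> {a \<in> topspace ?P. ideal_op i a \<in> U}"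
      proof
        fix b assume b: "b \<in> ?B"
        then have bT: "b \<in> {..<?n} \<rightarrow>\<^sub>E ideal ` X_terms" by (auto simp: PiE_iff)
        have "p \<in> ideal_op i b" using b ps unfolding ideal_op_def by auto
        then have "ideal_op i b \<in> U" using p(2) closed[OF bT] by blast
        then show "b \<in> {a \<in> topspace ?P. ideal_op i a \<in> U}"
          using bT by (simp add: topspace_ideal_topology)
      qed
      ultimately show "\<exists>T. openin ?P T \<and> a \<in> T \<and> T \<subseteq> {a \<in> topspace ?P. ideal_op i a \<in> U}" by blast
    qed
  qed
  then show "continuous_map (product_topology (\<lambda>_. alg_space ideal_algebra) {..<?n}) (alg_space ideal_algebra) (ideal_op i)"
    by (simp add: ideal_algebra_def)
qed

lemma dtop_algebra_ideal_algebra: "dtop_algebra \<Sigma> ideal_algebra"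
  unfolding dtop_algebra_def
  using algebraic_space_ideal_algebra continuous_map_ideal_op
  by (auto simp: algebraic_space_def ideal_algebra_def)

text \<open>An approximant of the left-hand side is first raised to a substitution instance of
  \<open>\<tau>\<^sub>1\<close> over compact terms, where the inequality is available by definition of \<open>le\<close>; the resulting instance of
  \<open>\<tau>\<^sub>2\<close> approximates the right-hand side.\<close>

lemma ideal_subst_mono:
  assumes e: "(\<tau>\<^sub>1, \<tau>\<^sub>2) \<in> E" and s: "\<And>v. s v \<in> X_terms"
  shows "ideal (subst s \<tau>\<^sub>1) \<subseteq> ideal (subst s \<tau>\<^sub>2)"
proof
  have \<tau>: "\<tau>\<^sub>1 \<in> sig_terms \<Sigma> UNIV" "\<tau>\<^sub>2 \<in> sig_terms \<Sigma> UNIV" using e E by auto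
  fix p assume "p \<in> ideal (subst s \<tau>\<^sub>1)"
  then obtain q where q: "approx q (subst s \<tau>\<^sub>1)" "le p q" unfolding ideal_def by blast
  then obtain \<sigma> where \<sigma>: "\<forall>v. approx (\<sigma> v) (s v)" "le q (subst \<sigma> \<tau>\<^sub>1)"
    using approx_subst_cofinal[OF \<tau>(1), of s q] s by blast
  have "le (subst \<sigma> \<tau>\<^sub>1) (subst \<sigma> \<tau>\<^sub>2)"
    using le_ineq[OF e] \<sigma>(1) approx_K_terms by blast
  then have "le p (subst \<sigma> \<tau>\<^sub>2)" using q(2) \<sigma>(2) le_trans by blast
  moreover have "approx (subst \<sigma> \<tau>\<^sub>2) (subst s \<tau>\<^sub>2)" using approx_subst[OF \<tau>(2)] \<sigma>(1) by blast
  ultimately show "p \<in> ideal (subst s \<tau>\<^sub>2)" unfolding ideal_def by blast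
qed

lemma dtop_obj_ideal_algebra: "dtop_obj \<Sigma> E ideal_algebra"
  unfolding dtop_obj_def
proof (intro conjI ballI dtop_algebra_ideal_algebra)
  fix e assume e: "e \<in> E"
  show "satisfies_ineq ideal_algebra e"
    unfolding satisfies_ineq_def
  proof (intro allI impI)
    fix h :: "nat \<Rightarrow> ('i, 'x) trm set"
    assume "\<forall>v. h v \<in> topspace (alg_space ideal_algebra)"
    then have "\<forall>v. \<exists>t\<in>X_terms. h v = ideal t" by auto
    then obtain s where s: "\<And>v. s v \<in> X_terms" "\<And>v. h v = ideal (s v)" by metis
    obtain \<tau>\<^sub>1 \<tau>\<^sub>2 where \<tau>: "e = (\<tau>\<^sub>1, \<tau>\<^sub>2)" by (cases e)
    then have "\<tau>\<^sub>1 \<in> sig_terms \<Sigma> UNIV" "\<tau>\<^sub>2 \<in> sig_terms \<Sigma> UNIV" using e E by auto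
    then have "spec_le (ideal_topology (ideal ` X_terms)) (ideal (subst s \<tau>\<^sub>1)) (ideal (subst s \<tau>\<^sub>2))"
      using ideal_subst_mono[of \<tau>\<^sub>1 \<tau>\<^sub>2 s] e \<tau> s(1)
      by (auto simp: spec_le_ideal_topology intro!: imageI subst_in_sig_terms)
    moreover have "eval_trm (alg_op ideal_algebra) h (fst e) = ideal (subst s \<tau>\<^sub>1)"
      "eval_trm (alg_op ideal_algebra) h (snd e) = ideal (subst s \<tau>\<^sub>2)"
      using eval_ideal_algebra[of _ UNIV h s] \<open>\<tau>\<^sub>1 \<in> _\<close> \<open>\<tau>\<^sub>2 \<in> _\<close> s(2) \<tau> by auto
    ultimately show "spec_le (alg_space ideal_algebra)
        (eval_trm (alg_op ideal_algebra) h (fst e)) (eval_trm (alg_op ideal_algebra) h (snd e))"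
      by (simp add: ideal_algebra_def)
  qed
qed

text \<open>A neighbourhood of \<open>ideal (Var x)\<close> is witnessed by a compact \<open>k\<close> below \<open>x\<close>, and pulls back to a set
  that contains the open set of all points above \<open>k\<close>.\<close>

lemma continuous_map_unit: "continuous_map X (alg_space ideal_algebra) (\<lambda>x. ideal (Var x))"
  unfolding continuous_map_def
proof (intro conjI allI impI)
  show "(\<lambda>x. ideal (Var x)) \<in> topspace X \<rightarrow> topspace (alg_space ideal_algebra)"
    by (auto intro: sig_terms.Var)
  fix U assume "openin (alg_space ideal_algebra) U"
  then have U: "openin (ideal_topology (ideal ` X_terms)) U" by (simp add: ideal_algebra_def)
  show "openin X {x \<in> topspace X. ideal (Var x) \<in> U}"
  proof (subst openin_subopen, intro ballI)
    fix x assume "x \<in> {x \<in> topspace X. ideal (Var x) \<in> U}"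
    then have "ideal (Var x) \<in> U" by simp
    from openin_ideal_topologyD[OF U this] obtain p where p: "p \<in> ideal (Var x)"
      "\<And>J. J \<in> ideal ` X_terms \<Longrightarrow> p \<in> J \<Longrightarrow> J \<in> U"
      by metis
    then obtain q where q: "approx q (Var x)" "le p q" unfolding ideal_def by blast
    from q(1) obtain k where k: "q = Var k" "k \<in> compact_elements X" "spec_le X k x"
      by (rule approx_to_Var) auto
    have "ideal (Var y) \<in> U" if "spec_le X k y" for y
    proof (rule p(2))
      show "ideal (Var y) \<in> ideal ` X_terms"
        using that by (auto simp: spec_le_iff intro: sig_terms.Var)
      show "p \<in> ideal (Var y)"
        using q k that approx_Var unfolding ideal_def by blast
    qed
    then have "{y. spec_le X k y} \<subseteq> {x \<in> topspace X. ideal (Var x) \<in> U}"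
      by (auto simp: spec_le_iff)
    moreover have "openin X {y. spec_le X k y}"
      using X k(2) by (intro openin_up_compact) (auto simp: algebraic_space_def)
    ultimately show "\<exists>T. openin X T \<and> x \<in> T \<and> T \<subseteq> {x \<in> topspace X. ideal (Var x) \<in> U}"
      using k(3) by (intro exI[of _ "{y. spec_le X k y}"]) auto
  qed
qed

section \<open>The universal property\<close>

context
  fixes B :: "('i, 'b) top_alg" and \<phi> :: "'x \<Rightarrow> 'b"
  assumes B: "dtop_obj \<Sigma> E B" and \<phi>: "continuous_map X (alg_space B) \<phi>"
begin

abbreviation ev :: "('i, 'x) trm \<Rightarrow> 'b" where
  "ev \<equiv> eval_trm (alg_op B) \<phi>"

lemma dtop_algebra_B: "dtop_algebra \<Sigma> B"
  using B by (simp add: dtop_obj_def)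

lemma ev_closed: "t \<in> X_terms \<Longrightarrow> ev t \<in> topspace (alg_space B)"
  using \<phi> by (intro eval_trm_closed[OF dtop_algebra_B]) (auto simp: continuous_map_def)

lemma ev_App_mono:
  assumes "i \<in> symbols \<Sigma>" "length ps = arity \<Sigma> i" "length qs = arity \<Sigma> i"
    and "\<And>k. k < arity \<Sigma> i \<Longrightarrow> spec_le (alg_space B) (ev (ps ! k)) (ev (qs ! k))"
  shows "spec_le (alg_space B) (ev (App i ps)) (ev (App i qs))"
  unfolding eval_trm_App assms(2,3)
  by (rule alg_op_mono[OF dtop_algebra_B assms(1)]) (rule assms(4))

text \<open>Soundness of \<open>le\<close>: each rule generating it holds in \<open>B\<close>.\<close>

lemma ev_le: "le p q \<Longrightarrow> spec_le (alg_space B) (ev p) (ev q)"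
proof (induction rule: le.induct)
  case (le_Var k l)
  then show ?case using continuous_map_spec_le[OF \<phi>] by simp
next
  case (le_App i ps qs)
  then show ?case by (intro ev_App_mono) auto
next
  case (le_ineq \<tau>\<^sub>1 \<tau>\<^sub>2 \<sigma>)
  then have "\<forall>v. ev (\<sigma> v) \<in> topspace (alg_space B)" using ev_closed K_terms_subset by blast
  moreover have "satisfies_ineq B (\<tau>\<^sub>1, \<tau>\<^sub>2)" using B le_ineq(1) unfolding dtop_obj_def by blast
  ultimately show ?case
    unfolding satisfies_ineq_def eval_trm_subst by simp
next
  case (le_refl p)
  then show ?case using ev_closed K_terms_subset by (blast intro: spec_le_refl)
next
  case (le_trans p q r)
  then show ?case by (blast intro: spec_le_trans)
qed

lemma ev_approx: "approx p t \<Longrightarrow> spec_le (alg_space B) (ev p) (ev t)"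
proof (induction rule: approx.induct)
  case (approx_Var k x)
  then show ?case using continuous_map_spec_le[OF \<phi>] by simp
next
  case (approx_App i ps ts)
  then show ?case by (intro ev_App_mono) auto
qed

text \<open>The values of the approximants converge to the value of the term. The operations of \<open>B\<close> are
  continuous on the power in the category of directed spaces, whose topology may be finer than the
  product topology, so a neighbourhood of the value pulls back only to a directed-open set \<open>W\<close> of
  argument tuples. However, the tuples of values of approximants are directed and
  converge to the tuple of values in the product topology, so one of them lies in \<open>W\<close>.\<close>

lemma ev_approx_converges:
  assumes "t \<in> X_terms" and "openin (alg_space B) U" and "ev t \<in> U"
  shows "\<exists>p. approx p t \<and> ev p \<in> U"
  using assms
proof (induction arbitrary: U)
  case (Var x)
  have "openin X {y \<in> topspace X. \<phi> y \<in> U}"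
    using \<phi> Var(2) by (rule openin_continuous_map_preimage)
  moreover have "converges_to X {k \<in> compact_elements X. spec_le X k x} x"
    using X Var(1) by (simp add: algebraic_space_def)
  ultimately obtain k where "k \<in> compact_elements X" "spec_le X k x" "\<phi> k \<in> U"
    using Var(1,3) unfolding converges_to_def by fastforce
  then show ?case by (intro exI[of _ "Var k"]) (simp add: approx_Var)
next
  case (App i ts)
  let ?n = "arity \<Sigma> i" and ?BT = "alg_space B"
  let ?P = "product_topology (\<lambda>_. ?BT) {..<?n}"
  let ?tuple = "\<lambda>ps. \<lambda>k\<in>{..<?n}. ev (ps ! k)"
  let ?A = "{ps. length ps = ?n \<and> (\<forall>k<?n. approx (ps ! k) (ts ! k))}"
  define W where "W = {a \<in> topspace (dpower ?BT ?n). alg_op B i a \<in> U}"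
  have ts: "ts ! k \<in> X_terms" if "k < ?n" for k using App(2,3) that by simp
  have IH: "\<exists>p. approx p (ts ! k) \<and> ev p \<in> V" if "k < ?n" "openin ?BT V" "ev (ts ! k) \<in> V" for k V
    using App(2,3) that by simp
  have tuple_in: "?tuple ps \<in> topspace ?P" if "\<And>k. k < ?n \<Longrightarrow> ps ! k \<in> X_terms" for ps
    using that ev_closed by auto
  have A_terms: "ps ! k \<in> X_terms" if "ps \<in> ?A" "k < ?n" for ps k
    using that approx_K_terms K_terms_subset by blast
  have "continuous_map (dpower ?BT ?n) ?BT (alg_op B i)"
    using dtop_algebra_B App(1) by (simp add: dtop_algebra_def)
  then have "openin (dpower ?BT ?n) W"
    unfolding W_def using App(4) by (rule openin_continuous_map_preimage)
  then have W: "directed_open ?P W"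
    by (simp add: dpower_def openin_dir_topology)
  have "?tuple ts \<in> W"
    using App(2,5) tuple_in[of ts] ts unfolding W_def eval_trm_App by simp
  moreover have "directed_in ?P (?tuple ` ?A)"
    unfolding directed_in_def
  proof (intro conjI ballI)
    show "?tuple ` ?A \<subseteq> topspace ?P" using tuple_in A_terms by blast
    have "\<forall>k<?n. \<exists>p. approx p (ts ! k)" using ex_approx ts by blast
    then obtain c where "\<forall>k<?n. approx (c k) (ts ! k)" by metis
    then have "map c [0..<?n] \<in> ?A" by simp
    then show "?tuple ` ?A \<noteq> {}" by blast
  next
    fix a b assume "a \<in> ?tuple ` ?A" "b \<in> ?tuple ` ?A"
    then obtain ps qs where ab: "ps \<in> ?A" "a = ?tuple ps" "qs \<in> ?A" "b = ?tuple qs" by blast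
    then have "\<forall>k<?n. \<exists>r. approx r (ts ! k) \<and> le (ps ! k) r \<and> le (qs ! k) r"
      using approx_directed by blast
    then obtain c where c: "\<forall>k<?n. approx (c k) (ts ! k) \<and> le (ps ! k) (c k) \<and> le (qs ! k) (c k)"
      by metis
    let ?rs = "map c [0..<?n]"
    have rs: "?rs \<in> ?A" using c by simp
    have "spec_le ?P (?tuple us) (?tuple ?rs)" if "us \<in> ?A" "\<forall>k<?n. le (us ! k) (c k)" for us
    proof (rule spec_le_product)
      show "?tuple us \<in> topspace ?P" by (rule tuple_in) (rule A_terms[OF that(1)])
      show "?tuple ?rs \<in> topspace ?P" by (rule tuple_in) (rule A_terms[OF rs])
      show "spec_le ?BT (?tuple us k) (?tuple ?rs k)" if "k \<in> {..<?n}" for k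
        using that \<open>\<forall>k<?n. le (us ! k) (c k)\<close> ev_le by simp
    qed
    then have "spec_le ?P a (?tuple ?rs)" "spec_le ?P b (?tuple ?rs)"
      unfolding ab(2,4) using ab(1,3) c by blast+
    then show "\<exists>c\<in>?tuple ` ?A. spec_le ?P a c \<and> spec_le ?P b c"
      using rs by blast
  qed
  moreover have "converges_to ?P (?tuple ` ?A) (?tuple ts)"
    unfolding converges_to_def
  proof (intro conjI allI impI)
    show "?tuple ts \<in> topspace ?P" by (rule tuple_in) (rule ts)
    fix V assume "openin ?P V \<and> ?tuple ts \<in> V"
    then have "\<exists>N. finite {k \<in> {..<?n}. N k \<noteq> topspace ?BT} \<and> (\<forall>k\<in>{..<?n}. openin ?BT (N k)) \<and>
        ?tuple ts \<in> Pi\<^sub>E {..<?n} N \<and> Pi\<^sub>E {..<?n} N \<subseteq> V"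
      unfolding openin_product_topology_alt by (elim conjE bspec)
    then obtain N where N: "\<And>k. k < ?n \<Longrightarrow> openin ?BT (N k)" "?tuple ts \<in> Pi\<^sub>E {..<?n} N"
      "Pi\<^sub>E {..<?n} N \<subseteq> V"
      by auto
    have "\<exists>p. approx p (ts ! k) \<and> ev p \<in> N k" if "k < ?n" for k
      using IH[OF that N(1)[OF that]] PiE_mem[OF N(2), of k] that by simp
    then obtain c where c: "\<And>k. k < ?n \<Longrightarrow> approx (c k) (ts ! k) \<and> ev (c k) \<in> N k" by metis
    let ?ps = "map c [0..<?n]"
    have "?ps \<in> ?A" using c by simp
    moreover have "?tuple ?ps \<in> Pi\<^sub>E {..<?n} N" using c by auto
    ultimately show "?tuple ` ?A \<inter> V \<noteq> {}" using N(3) by blast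
  qed
  ultimately have "?tuple ` ?A \<inter> W \<noteq> {}"
    using W unfolding directed_open_def by blast
  then obtain ps where ps: "ps \<in> ?A" "?tuple ps \<in> W" by blast
  then have "approx (App i ps) (App i ts)" "ev (App i ps) \<in> U"
    using App(1,2) unfolding W_def eval_trm_App by (auto intro: approx_App)
  then show ?case by blast
qed

lemma ev_ideal:
  assumes "p \<in> ideal t"
  shows "spec_le (alg_space B) (ev p) (ev t)"
proof -
  from assms obtain q where "approx q t" "le p q" unfolding ideal_def by blast
  then show ?thesis using spec_le_trans[OF ev_le ev_approx] by blast
qed

text \<open>Two terms with the same ideal have the same value, by this lemma and the \<open>T\<^sub>0\<close> axiom.\<close>

lemma ev_mono_ideal:
  assumes t: "t \<in> X_terms" and s: "s \<in> X_terms" and sub: "ideal t \<subseteq> ideal s"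
  shows "spec_le (alg_space B) (ev t) (ev s)"
  unfolding spec_le_iff
proof (intro conjI allI impI ev_closed t s)
  fix U assume U: "openin (alg_space B) U \<and> ev t \<in> U"
  then obtain p where p: "approx p t" "ev p \<in> U" using ev_approx_converges[OF t] by blast
  then have "spec_le (alg_space B) (ev p) (ev s)" using ev_ideal approx_in_ideal sub by blast
  then show "ev s \<in> U" using U p(2) by (simp add: spec_le_iff)
qed

text \<open>If the value of \<open>t\<close> lies in an open \<open>U\<close>, so does that of some approximant \<open>p\<close>, and then that of
  every term whose ideal contains \<open>p\<close>; this is continuity.\<close>

lemma ex_hom_ideal_algebra:
  "\<exists>g. dtop_hom \<Sigma> ideal_algebra B g \<and> (\<forall>t\<in>X_terms. g (ideal t) = ev t)"
proof (intro exI conjI ballI)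
  define g where "g J = ev (SOME t. t \<in> X_terms \<and> ideal t = J)" for J
  show g: "g (ideal t) = ev t" if t: "t \<in> X_terms" for t
  proof -
    let ?s = "SOME s. s \<in> X_terms \<and> ideal s = ideal t"
    have s: "?s \<in> X_terms \<and> ideal ?s = ideal t"
      by (rule someI[of _ t]) (simp add: t)
    have "t0_space (alg_space B)"
      using dtop_algebra_B by (simp add: dtop_algebra_def directed_space_def)
    then have "ev ?s = ev t"
      using s t by (intro spec_le_antisym[of "alg_space B"] ev_mono_ideal) auto
    then show ?thesis by (simp add: g_def)
  qed
  have cont: "continuous_map (alg_space ideal_algebra) (alg_space B) g"
    unfolding continuous_map_def
  proof (intro conjI allI impI)
    show "g \<in> topspace (alg_space ideal_algebra) \<rightarrow> topspace (alg_space B)"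
      using g ev_closed by auto
    fix U assume U: "openin (alg_space B) U"
    let ?V = "{J \<in> ideal ` X_terms. g J \<in> U}"
    have "openin (ideal_topology (ideal ` X_terms)) ?V"
      unfolding openin_ideal_topology
    proof (intro conjI ballI)
      fix I assume "I \<in> ?V"
      then obtain t where t: "I = ideal t" "t \<in> X_terms" "ev t \<in> U" using g by auto
      then obtain p where p: "approx p t" "ev p \<in> U" using ev_approx_converges U by blast
      have "J \<in> ?V" if "J \<in> ideal ` X_terms" "p \<in> J" for J
      proof -
        from that obtain s where s: "J = ideal s" "s \<in> X_terms" "p \<in> ideal s" by blast
        then have "ev s \<in> U" using ev_ideal[OF s(3)] U p(2) by (simp add: spec_le_iff)
        then show ?thesis using s g by simp
      qed
      then show "\<exists>p\<in>I. \<forall>J\<in>ideal ` X_terms. p \<in> J \<longrightarrow> J \<in> ?V"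
        using approx_in_ideal[OF p(1)] t(1) by blast
    qed blast
    then show "openin (alg_space ideal_algebra) {J \<in> topspace (alg_space ideal_algebra). g J \<in> U}"
      by (simp add: ideal_algebra_def topspace_ideal_topology)
  qed
  show "dtop_hom \<Sigma> ideal_algebra B g"
    unfolding dtop_hom_def
  proof (intro conjI ballI cont)
    fix i a assume i: "i \<in> symbols \<Sigma>"
      and "a \<in> {..<arity \<Sigma> i} \<rightarrow>\<^sub>E topspace (alg_space ideal_algebra)"
    then have "a \<in> {..<arity \<Sigma> i} \<rightarrow>\<^sub>E ideal ` X_terms" by simp
    then obtain ts where ts: "length ts = arity \<Sigma> i" "\<forall>k<arity \<Sigma> i. ts ! k \<in> X_terms"
      and a: "a = (\<lambda>k\<in>{..<arity \<Sigma> i}. ideal (ts ! k))"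
      by (rule tuple_of_ideals) blast
    have "alg_op ideal_algebra i a = ideal (App i ts)"
      unfolding a using ideal_op_ideal[OF i ts(1)] by (simp add: ideal_algebra_def)
    moreover have "App i ts \<in> X_terms" using ts i by (intro sig_terms_AppI) simp_all
    ultimately have "g (alg_op ideal_algebra i a) = ev (App i ts)" using g by simp
    also have "\<dots> = alg_op B i (\<lambda>k\<in>{..<arity \<Sigma> i}. g (a k))"
      unfolding eval_trm_App ts(1)
      by (intro arg_cong[of _ _ "alg_op B i"] restrict_ext) (simp add: a g ts(2))
    finally show "g (alg_op ideal_algebra i a) = alg_op B i (\<lambda>k\<in>{..<arity \<Sigma> i}. g (a k))" .
  qed
qed

end

end

section \<open>Algebraicity of free algebras\<close>

theorem proposition7p7:
  fixes \<Sigma> :: "'i signature"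
    and E :: "(('i, nat) trm \<times> ('i, nat) trm) set"
    and X :: "'x topology"
    and FX :: "('i, 'a) top_alg"
    and \<eta> :: "'x \<Rightarrow> 'a"
  assumes "E \<subseteq> sig_terms \<Sigma> UNIV \<times> sig_terms \<Sigma> UNIV"
    and "algebraic_space X"
    and "free_algebra \<Sigma> E X FX \<eta>"
  shows "algebraic_space (alg_space FX)"
proof -
  interpret algebraic_generators \<Sigma> E X
    using assms(1,2) by unfold_locales
  have FX: "dtop_obj \<Sigma> E FX" and \<eta>: "continuous_map X (alg_space FX) \<eta>"
    and univ_self: "universal_for TYPE('a) \<Sigma> E X FX \<eta>"
    and univ_terms: "universal_for TYPE(('i, 'x) trm set) \<Sigma> E X FX \<eta>"
    using assms(3) by (auto simp: free_algebra_def)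
  have FX_alg: "dtop_algebra \<Sigma> FX" using FX by (simp add: dtop_obj_def)
  have \<eta>_in: "\<eta> x \<in> topspace (alg_space FX)" if "x \<in> topspace X" for x
    using \<eta> that by (auto simp: continuous_map_def)
  obtain g where g: "dtop_hom \<Sigma> ideal_algebra FX g"
      "\<And>t. t \<in> X_terms \<Longrightarrow> g (ideal t) = eval_trm (alg_op FX) \<eta> t"
    using ex_hom_ideal_algebra[OF FX \<eta>] by blast
  obtain u where u: "dtop_hom \<Sigma> FX ideal_algebra u"
      "\<And>x. x \<in> topspace X \<Longrightarrow> u (\<eta> x) = ideal (Var x)"
    using univ_terms[unfolded universal_for_def, rule_format, of ideal_algebra "\<lambda>x. ideal (Var x)"]
      dtop_obj_ideal_algebra continuous_map_unit by blast
  \<comment> \<open>\<open>g \<circ> u\<close> and the identity are endomorphisms of \<open>FX\<close> that extend \<open>\<eta>\<close>.\<close>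
  have gu: "g (u a) = a" if "a \<in> topspace (alg_space FX)" for a
  proof -
    have "g (u (\<eta> x)) = \<eta> x" if "x \<in> topspace X" for x
      using u(2)[OF that] g(2)[of "Var x"] that by (simp add: sig_terms.Var)
    then show ?thesis
      using universal_for_unique[OF univ_self FX \<eta> dtop_hom_compose[OF u(1) g(1)] _
          dtop_hom_id[OF FX_alg] _ that] by simp
  qed
  \<comment> \<open>\<open>u\<close> preserves the evaluation of terms, and in the algebra of ideals \<open>t\<close> evaluates to \<open>ideal t\<close>.\<close>
  have ug: "u (g (ideal t)) = ideal t" if t: "t \<in> X_terms" for t
  proof -
    have "u (g (ideal t)) = eval_trm (alg_op ideal_algebra) (\<lambda>x. u (\<eta> x)) t"
      using g(2)[OF t] dtop_hom_eval_trm[OF u(1) FX_alg t \<eta>_in] by simp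
    also have "\<dots> = ideal (subst Var t)"
      using t u(2) by (rule eval_ideal_algebra)
    finally show ?thesis by (simp add: subst_Var)
  qed
  have "homeomorphic_maps (alg_space ideal_algebra) (alg_space FX) g u"
    using g(1) u(1) gu ug by (auto simp: homeomorphic_maps_def dtop_hom_def)
  then show ?thesis
    using algebraic_space_homeomorphic algebraic_space_ideal_algebra by blast
qed

end
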